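(* Let $k=\mathbb{Q}[y,y^{-1}]$ and let $H_n(X)$ denote the Yang-Baxter homology of $X=(V,R)$, as defined in the context. Then $$H_3(X)\cong k^{\oplus2}\oplus \bigl(k/(1-y^2)\bigr)^{\oplus2}\oplus\bigl(k/(1-y^4)\bigr)^{\oplus2}$$ as $k$-modules.
   Context: $V$ is the free $k$-module with basis $e_1,e_2$; tensor products are over $k$, and $\mathbb{1}^m$ is the identity of $V^{\otimes m}$ ($V^{\otimes0}=k$). The map $R:V\otimes V\to V\otimes V$ is the $k$-linear map with $R(e_1\otimes e_1)=e_1\otimes e_1$, $R(e_1\otimes e_2)=(1-y^2)e_1\otimes e_2+y^2e_2\otimes e_1$, $R(e_2\otimes e_1)=e_1\otimes e_2$, $R(e_2\otimes e_2)=e_2\otimes e_2$. Let $\mu:V\to k$ be the $k$-linear map with $\mu(e_1)=\mu(e_2)=1$. For $1\le i\le n$ define $d^\ell_{i,n},d^r_{i,n}:V^{\otimes n}\to V^{\otimes(n-1)}$ by $$d^\ell_{i,n}=(\mu\otimes\mathbb{1}^{n-1})\circ(R\otimes\mathbb{1}^{n-2})\circ(\mathbb{1}\otimes R\otimes\mathbb{1}^{n-3})\circ\cdots\circ(\mathbb{1}^{i-2}\otimes R\otimes\mathbb{1}^{n-i}),$$ $$d^r_{i,n}=(\mathbb{1}^{n-1}\otimes\mu)\circ(\mathbb{1}^{n-2}\otimes R)\circ(\mathbb{1}^{n-3}\otimes R\otimes\mathbb{1})\circ\cdots\circ(\mathbb{1}^{i-1}\otimes R\otimes\mathbb{1}^{n-i-1}),$$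 (so $d^\ell_{1,n}=\mu\otimes\mathbb{1}^{n-1}$ and $d^r_{n,n}=\mathbb{1}^{n-1}\otimes\mu$). Set $C_n(X)=V^{\otimes n}$ and $d_n=\sum_{i=1}^n(-1)^i[\,d^\ell_{i,n}-d^r_{i,n}\,]:C_n(X)\to C_{n-1}(X)$. These form a chain complex, and $H_n(X)=\ker d_n/\operatorname{im}d_{n+1}$. *)

theory Defs
  imports "HOL-Library.Poly_Mapping" "HOL-Algebra.Algebra" "HOL-Algebra.Algebraic_Closure_Type"
begin

text \<open>
  The record type of modules extends that of rings; the fields \<open>mult\<close> and \<open>one\<close>
  play no role for modules and are left unspecified.
\<close>

definition regular_module :: "('a, 'm) ring_scheme \<Rightarrow> ('a, 'a) module" where
  "regular_module R =
     \<lparr>carrier = carrier R, monoid.mult = undefined, one = undefined,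
      ring.zero = \<zero>\<^bsub>R\<^esub>, ring.add = (\<oplus>\<^bsub>R\<^esub>), module.smult = (\<otimes>\<^bsub>R\<^esub>)\<rparr>"

definition direct_sum :: "('a, 'b) module \<Rightarrow> ('a, 'c) module \<Rightarrow> ('a, 'b \<times> 'c) module" where
  "direct_sum M N =
     \<lparr>carrier = carrier M \<times> carrier N, monoid.mult = undefined, one = undefined,
      ring.zero = (\<zero>\<^bsub>M\<^esub>, \<zero>\<^bsub>N\<^esub>),
      ring.add = (\<lambda>(x, x') (z, z'). (x \<oplus>\<^bsub>M\<^esub> z, x' \<oplus>\<^bsub>N\<^esub> z')),
      module.smult = (\<lambda>a (x, x'). (a \<odot>\<^bsub>M\<^esub> x, a \<odot>\<^bsub>N\<^esub> x'))\<rparr>"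

text \<open>The quotient by a submodule \<open>N\<close>, on the additive cosets of \<open>N\<close>,
  analogous to the quotient of a ring by an ideal.\<close>

definition quotient_module :: "('a, 'b) module \<Rightarrow> 'b set \<Rightarrow> ('a, 'b set) module" where
  "quotient_module M N =
     \<lparr>carrier = a_rcosets\<^bsub>M\<^esub> N, monoid.mult = undefined, one = undefined,
      ring.zero = N, ring.add = (<+>\<^bsub>M\<^esub>),
      module.smult = (\<lambda>a A. \<Union>x\<in>A. N +>\<^bsub>M\<^esub> (a \<odot>\<^bsub>M\<^esub> x))\<rparr>"

definition module_iso ::
  "('r, 'm) ring_scheme \<Rightarrow> ('r, 'b) module \<Rightarrow> ('r, 'c) module \<Rightarrow> ('b \<Rightarrow> 'c) set" where
  "module_iso R M N =
     {h. bij_betw h (carrier M) (carrier N) \<and>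
         (\<forall>x\<in>carrier M. \<forall>z\<in>carrier M. h (x \<oplus>\<^bsub>M\<^esub> z) = h x \<oplus>\<^bsub>N\<^esub> h z) \<and>
         (\<forall>a\<in>carrier R. \<forall>x\<in>carrier M. h (a \<odot>\<^bsub>M\<^esub> x) = a \<odot>\<^bsub>N\<^esub> h x)}"

definition module_isomorphic ::
  "('r, 'm) ring_scheme \<Rightarrow> ('r, 'b) module \<Rightarrow> ('r, 'c) module \<Rightarrow> bool" where
  "module_isomorphic R M N \<longleftrightarrow> module_iso R M N \<noteq> {}"

text \<open>
  Finitely supported functions from the integers to the rationals with convolution
  as multiplication, that is, the group ring of the integers over the rationals:
  the function \<open>c\<close> stands for the sum of all \<open>c j y\<^sup>j\<close>.
\<close>

type_synonym laurent = "int \<Rightarrow>\<^sub>0 rat"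

definition yvar :: laurent where
  "yvar = Poly_Mapping.single 1 1"

abbreviation laurent_ring :: "laurent ring" where
  "laurent_ring \<equiv> ring_of_type_algebra"

datatype basis = E1 | E2

text \<open>
  The \<open>n\<close>-th tensor power of the free module \<open>V\<close> on \<open>E1\<close>, \<open>E2\<close> is
  the free module on the words of length \<open>n\<close>, the word \<open>[x\<^sub>1, \<dots>, x\<^sub>n]\<close> standing for
  \<open>x\<^sub>1 \<otimes> \<dots> \<otimes> x\<^sub>n\<close>. In particular the zeroth power is free on the
  empty word, which stands for the unit of the ground ring. All tensor powers
  live in one type of formal linear combinations of words.
\<close>

type_synonym tens = "basis list \<Rightarrow>\<^sub>0 laurent"

definition tscale :: "laurent \<Rightarrow> tens \<Rightarrow> tens" where
  "tscale c v = Poly_Mapping.map ((*) c) v"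

definition word :: "basis list \<Rightarrow> tens" where
  "word w = Poly_Mapping.single w 1"

definition tensor_power :: "nat \<Rightarrow> (laurent, tens) module" where
  "tensor_power n =
     \<lparr>carrier = {v. \<forall>w \<in> Poly_Mapping.keys v. length w = n}, monoid.mult = undefined, one = undefined,
      ring.zero = 0, ring.add = (+), module.smult = tscale\<rparr>"

definition lin_ext :: "(basis list \<Rightarrow> tens) \<Rightarrow> tens \<Rightarrow> tens" where
  "lin_ext \<phi> v = (\<Sum>w \<in> Poly_Mapping.keys v. tscale (Poly_Mapping.lookup v w) (\<phi> w))"

definition tensor :: "tens \<Rightarrow> tens \<Rightarrow> tens" where
  "tensor u v =
     (\<Sum>w \<in> Poly_Mapping.keys u. \<Sum>w' \<in> Poly_Mapping.keys v.
        tscale (Poly_Mapping.lookup u w * Poly_Mapping.lookup v w') (word (w @ w')))"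

text \<open>
  \<open>map_tensor a f g\<close> is the tensor product of linear maps \<open>f \<otimes> g\<close>, where the domain
  of \<open>f\<close> is the \<open>a\<close>-th tensor power. The domain of \<open>g\<close> is the \<open>b\<close>-th tensor power if
  the map is applied to elements of the \<open>(a+b)\<close>-th one; so \<open>id\<close> serves as
  the identity of every tensor power.
\<close>

definition map_tensor :: "nat \<Rightarrow> (tens \<Rightarrow> tens) \<Rightarrow> (tens \<Rightarrow> tens) \<Rightarrow> tens \<Rightarrow> tens" where
  "map_tensor a f g = lin_ext (\<lambda>w. tensor (f (word (take a w))) (g (word (drop a w))))"

text \<open>The values of \<open>R_map\<close> and \<open>mu_map\<close> outside the second, respectively first, tensor
  power are irrelevant.\<close>

definition R_map :: "tens \<Rightarrow> tens" where
  "R_map = lin_ext (\<lambda>w.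
     if w = [E1, E1] then word [E1, E1]
     else if w = [E1, E2] then tscale (1 - yvar^2) (word [E1, E2]) + tscale (yvar^2) (word [E2, E1])
     else if w = [E2, E1] then word [E1, E2]
     else if w = [E2, E2] then word [E2, E2]
     else 0)"

definition mu_map :: "tens \<Rightarrow> tens" where
  "mu_map = lin_ext (\<lambda>w. if w = [E1] \<or> w = [E2] then word [] else 0)"

text \<open>\<open>R_at a\<close> is \<open>1\<^sup>a \<otimes> R \<otimes> 1\<^sup>b\<close>, with \<open>b\<close> determined by the argument.\<close>

definition R_at :: "nat \<Rightarrow> tens \<Rightarrow> tens" where
  "R_at a = map_tensor a id (map_tensor 2 R_map id)"

text \<open>
  \<open>d_left n i\<close> is \<open>(\<mu> \<otimes> 1) \<circ> R_at 0 \<circ> R_at 1 \<circ> \<dots> \<circ> R_at (i-2)\<close> and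
  \<open>d_right n i\<close> is \<open>(1 \<otimes> \<mu>) \<circ> R_at (n-2) \<circ> R_at (n-3) \<circ> \<dots> \<circ> R_at (i-1)\<close>,
  for \<open>1 \<le> i \<le> n\<close>. The rightmost factor is applied first. The right-hand side of
  \<open>d_left n i\<close> does not mention \<open>n\<close>, which only determines the identity factors on the right.
\<close>

definition d_left :: "nat \<Rightarrow> nat \<Rightarrow> tens \<Rightarrow> tens" where
  "d_left n i = map_tensor 1 mu_map id \<circ> foldr (\<circ>) (map R_at [0..<i-1]) id"

definition d_right :: "nat \<Rightarrow> nat \<Rightarrow> tens \<Rightarrow> tens" where
  "d_right n i = map_tensor (n-1) id mu_map \<circ> foldr (\<circ>) (map R_at (rev [i-1..<n-1])) id"

definition YB_boundary :: "nat \<Rightarrow> tens \<Rightarrow> tens" where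
  "YB_boundary n v = (\<Sum>i=1..n. tscale ((-1)^i) (d_left n i v - d_right n i v))"

definition YB_cycles :: "nat \<Rightarrow> tens set" where
  "YB_cycles n = {v \<in> carrier (tensor_power n). YB_boundary n v = 0}"

definition YB_boundaries :: "nat \<Rightarrow> tens set" where
  "YB_boundaries n = YB_boundary (Suc n) ` carrier (tensor_power (Suc n))"

definition YB_homology :: "nat \<Rightarrow> (laurent, tens set) module" where
  "YB_homology n = quotient_module ((tensor_power n)\<lparr>carrier := YB_cycles n\<rparr>) (YB_boundaries n)"

definition cyclic_module :: "laurent \<Rightarrow> (laurent, laurent set) module" where
  "cyclic_module a = quotient_module (regular_module laurent_ring) (PIdl\<^bsub>laurent_ring\<^esub> a)"

end

theory Submission
  imports Defs
begin

text \<open>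
  Put \<open>t = y\<^sup>2\<close> and write \<open>112\<close> for \<open>e\<^sub>1 \<otimes> e\<^sub>1 \<otimes> e\<^sub>2\<close>, etc. The 3-cycles are free on the six words other than \<open>112\<close> and \<open>122\<close>. With
  \<open>A = 121 + t 211 - (1 + t) 221\<close> and \<open>A' = 212 + t 221 - (1 + t) 211\<close>, the elements
  \<open>221\<close>, \<open>211\<close>, \<open>A\<close>, \<open>A'\<close>, \<open>221 - 111\<close>, \<open>222 - 211\<close> form another basis of the cycles, in which the
  boundaries are diagonal: they are generated by \<open>(1 - t) A\<close>, \<open>(1 - t) A'\<close>,
  \<open>(1 - t\<^sup>2) (221 - 111)\<close> and \<open>(1 - t\<^sup>2) (222 - 211)\<close>. The coordinate functions of this basis
  therefore induce the isomorphism.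
\<close>

section \<open>Quotient modules\<close>

context module
begin

lemma submodule_abelian_subgroup: "submodule B R M \<Longrightarrow> abelian_subgroup B M"
  by (intro abelian_subgroupI3 additive_subgroup.intro submodule.axioms(1) M.abelian_group_axioms)

text \<open>\<open>quotient_module\<close> multiplies a coset by taking a union over its
  representatives. Two representatives differ by an element b of B, and a b lies in B again, so
  every set in the union is the same coset.\<close>

lemma coset_smult:
  assumes B: "submodule B R M" and a: "a \<in> carrier R" and x: "x \<in> carrier M"
  shows "(\<Union>z\<in>B +>\<^bsub>M\<^esub> x. B +>\<^bsub>M\<^esub> (a \<odot>\<^bsub>M\<^esub> z)) = B +>\<^bsub>M\<^esub> (a \<odot>\<^bsub>M\<^esub> x)"
proof -
  interpret B: abelian_subgroup B M using B by (rule submodule_abelian_subgroup)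
  have "B +>\<^bsub>M\<^esub> (a \<odot>\<^bsub>M\<^esub> z) = B +>\<^bsub>M\<^esub> (a \<odot>\<^bsub>M\<^esub> x)" if z: "z \<in> B +>\<^bsub>M\<^esub> x" for z
  proof -
    obtain b where b: "b \<in> B" "z = b \<oplus>\<^bsub>M\<^esub> x"
      using z by (auto simp: a_r_coset_def')
    have "a \<odot>\<^bsub>M\<^esub> z = a \<odot>\<^bsub>M\<^esub> b \<oplus>\<^bsub>M\<^esub> a \<odot>\<^bsub>M\<^esub> x"
      using a b x by (simp add: smult_r_distr)
    moreover have "a \<odot>\<^bsub>M\<^esub> b \<in> B"
      using B a b(1) by (rule submodule.smult_closed)
    ultimately have "a \<odot>\<^bsub>M\<^esub> z \<in> B +>\<^bsub>M\<^esub> (a \<odot>\<^bsub>M\<^esub> x)"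
      by (auto simp: a_r_coset_def')
    then show ?thesis
      using a x by (metis B.a_repr_independence' smult_closed)
  qed
  then show ?thesis
    using B.a_rcos_self[OF x] by blast
qed

lemma coset_eq_iff:
  assumes B: "submodule B R M" and x: "x \<in> carrier M" and z: "z \<in> carrier M"
  shows "B +>\<^bsub>M\<^esub> x = B +>\<^bsub>M\<^esub> z \<longleftrightarrow> (\<exists>b\<in>B. x = b \<oplus>\<^bsub>M\<^esub> z)"
proof -
  interpret B: abelian_subgroup B M using B by (rule submodule_abelian_subgroup)
  have "B +>\<^bsub>M\<^esub> x = B +>\<^bsub>M\<^esub> z \<longleftrightarrow> x \<in> B +>\<^bsub>M\<^esub> z"
    using x z B.a_repr_independence' B.a_repr_independenceD by metis
  then show ?thesis
    by (auto simp: a_r_coset_def')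
qed

end

text \<open>The hypothesis on fibres replaces the usual one on the kernel: it involves no
  subtraction in N, so the iterated direct sum used as N later never has to be shown to be a
  module.\<close>

theorem first_isomorphism:
  fixes R :: "('a, 'm) ring_scheme" and M :: "('a, 'b) module" and N :: "('a, 'c) module"
  assumes M: "module R M"
    and B: "submodule B R M"
    and onto: "h ` carrier M = carrier N"
    and add: "\<And>x z. x \<in> carrier M \<Longrightarrow> z \<in> carrier M \<Longrightarrow> h (x \<oplus>\<^bsub>M\<^esub> z) = h x \<oplus>\<^bsub>N\<^esub> h z"
    and smult: "\<And>a x. a \<in> carrier R \<Longrightarrow> x \<in> carrier M \<Longrightarrow> h (a \<odot>\<^bsub>M\<^esub> x) = a \<odot>\<^bsub>N\<^esub> h x"
    and fibres: "\<And>x z. x \<in> carrier M \<Longrightarrow> z \<in> carrier M \<Longrightarrow>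
      h x = h z \<longleftrightarrow> B +>\<^bsub>M\<^esub> x = B +>\<^bsub>M\<^esub> z"
  shows "module_isomorphic R (quotient_module M B) N"
proof -
  interpret module R M by (rule M)
  interpret B: abelian_subgroup B M using B by (rule submodule_abelian_subgroup)
  \<comment> \<open>h is constant on each coset of B, so the image of a coset is a singleton, and
    its element is the value of the induced map.\<close>
  let ?g = "\<lambda>A. the_elem (h ` A)"
  have g: "?g (B +>\<^bsub>M\<^esub> x) = h x" if x: "x \<in> carrier M" for x
  proof -
    have "h z = h x" if "z \<in> B +>\<^bsub>M\<^esub> x" for z
      using B.a_elemrcos_carrier[OF x that] B.a_repr_independence'[OF that x] x
      by (simp add: fibres)
    then have "h ` (B +>\<^bsub>M\<^esub> x) = {h x}"
      using B.a_rcos_self[OF x] by blast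
    then show ?thesis by simp
  qed
  have cosets: "a_rcosets\<^bsub>M\<^esub> B = (\<lambda>x. B +>\<^bsub>M\<^esub> x) ` carrier M"
    by (auto simp: A_RCOSETS_def')
  have "bij_betw ?g (a_rcosets\<^bsub>M\<^esub> B) (carrier N)"
    unfolding bij_betw_def cosets onto[symmetric] image_image
    by (auto simp: inj_on_def g fibres intro!: image_cong)
  moreover have "?g (A <+>\<^bsub>M\<^esub> A') = ?g A \<oplus>\<^bsub>N\<^esub> ?g A'"
    if "A \<in> a_rcosets\<^bsub>M\<^esub> B" "A' \<in> a_rcosets\<^bsub>M\<^esub> B" for A A'
    using that by (auto simp: cosets B.a_rcos_sum g add)
  moreover have "?g (\<Union>x\<in>A. B +>\<^bsub>M\<^esub> (a \<odot>\<^bsub>M\<^esub> x)) = a \<odot>\<^bsub>N\<^esub> ?g A"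
    if "a \<in> carrier R" "A \<in> a_rcosets\<^bsub>M\<^esub> B" for a A
    using that by (auto simp: cosets coset_smult[OF B] g smult)
  ultimately have "?g \<in> module_iso R (quotient_module M B) N"
    by (auto simp: module_iso_def quotient_module_def)
  then show ?thesis
    by (auto simp: module_isomorphic_def)
qed

section \<open>The ground ring as a module and its cyclic quotients\<close>

lemma (in cring) regular_module_is_module: "module R (regular_module R)"
proof (intro moduleI abelian_groupI)
  fix x assume "x \<in> carrier (regular_module R)"
  then show "\<exists>z\<in>carrier (regular_module R).
      z \<oplus>\<^bsub>regular_module R\<^esub> x = \<zero>\<^bsub>regular_module R\<^esub>"
    by (intro bexI[of _ "\<ominus> x"]) (simp_all add: regular_module_def l_neg)
qed (auto simp: regular_module_def is_cring l_distr r_distr m_assoc a_ac)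

lemma laurent_ring_simps [simp]:
  "carrier laurent_ring = UNIV" "x \<oplus>\<^bsub>laurent_ring\<^esub> z = x + z" "x \<otimes>\<^bsub>laurent_ring\<^esub> z = x * z"
  "\<one>\<^bsub>laurent_ring\<^esub> = 1" "\<zero>\<^bsub>laurent_ring\<^esub> = 0"
  by (simp_all add: ring_of_type_algebra_def)

lemma cgenideal_laurent_ring: "PIdl\<^bsub>laurent_ring\<^esub> a = {x. a dvd x}"
  by (auto simp: cgenideal_def dvd_def mult.commute)

interpretation laurent: module laurent_ring "regular_module laurent_ring"
  by (intro cring.regular_module_is_module cring_from_type_algebra)

lemma submodule_dvd: "submodule {x. a dvd x} laurent_ring (regular_module laurent_ring)"
proof (intro laurent.submoduleI)
  fix x assume "x \<in> {x. a dvd x}"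
  moreover have "\<ominus>\<^bsub>regular_module laurent_ring\<^esub> x = - x"
    by (rule laurent.M.minus_equality) (auto simp: regular_module_def)
  ultimately show "\<ominus>\<^bsub>regular_module laurent_ring\<^esub> x \<in> {x. a dvd x}"
    by simp
qed (auto simp: regular_module_def)

text \<open>The class of x in k/(a). Describing the principal ideal by divisibility turns equality
  of classes into a divisibility of differences.\<close>

definition residue :: "laurent \<Rightarrow> laurent \<Rightarrow> laurent set" where
  "residue a x = {x. a dvd x} +>\<^bsub>regular_module laurent_ring\<^esub> x"

lemma residue_eq_iff: "residue a x = residue a z \<longleftrightarrow> a dvd x - z"
  using laurent.coset_eq_iff[OF submodule_dvd, of x z a]
  by (auto simp: residue_def regular_module_def intro!: bexI[of _ "x - z"])

lemma carrier_cyclic_module: "carrier (cyclic_module a) = range (residue a)"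
  by (auto simp: cyclic_module_def quotient_module_def cgenideal_laurent_ring A_RCOSETS_def'
      residue_def regular_module_def)

lemma add_cyclic_module: "residue a x \<oplus>\<^bsub>cyclic_module a\<^esub> residue a z = residue a (x + z)"
  using abelian_subgroup.a_rcos_sum[OF laurent.submodule_abelian_subgroup[OF submodule_dvd],
      of x z a]
  by (simp add: cyclic_module_def quotient_module_def cgenideal_laurent_ring residue_def)
    (simp add: regular_module_def)

lemma smult_cyclic_module: "c \<odot>\<^bsub>cyclic_module a\<^esub> residue a x = residue a (c * x)"
  using laurent.coset_smult[OF submodule_dvd, of c x a]
  by (simp add: cyclic_module_def quotient_module_def cgenideal_laurent_ring residue_def)
    (simp add: regular_module_def)

lemma direct_sum_simps [simp]:
  "carrier (direct_sum M N) = carrier M \<times> carrier N"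
  "(x, x') \<oplus>\<^bsub>direct_sum M N\<^esub> (z, z') = (x \<oplus>\<^bsub>M\<^esub> z, x' \<oplus>\<^bsub>N\<^esub> z')"
  "a \<odot>\<^bsub>direct_sum M N\<^esub> (x, x') = (a \<odot>\<^bsub>M\<^esub> x, a \<odot>\<^bsub>N\<^esub> x')"
  by (simp_all add: direct_sum_def)

lemma regular_module_simps:
  "carrier (regular_module laurent_ring) = UNIV"
  "x \<oplus>\<^bsub>regular_module laurent_ring\<^esub> z = x + z"
  "a \<odot>\<^bsub>regular_module laurent_ring\<^esub> x = a * x"
  by (simp_all add: regular_module_def)

section \<open>Linear maps on tensor powers\<close>

abbreviation lk :: "tens \<Rightarrow> basis list \<Rightarrow> laurent" where
  "lk \<equiv> Poly_Mapping.lookup"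

lemma lookup_tscale [simp]:
  "lk (tscale c v) w = c * lk v w"
  unfolding tscale_def by transfer (simp add: when_def)

lemma lookup_word: "lk (word w) z = (if w = z then 1 else 0)"
  by (simp add: word_def lookup_single when_def)

lemma tscale_add_right: "tscale c (u + v) = tscale c u + tscale c v"
  and tscale_add_left: "tscale (a + b) v = tscale a v + tscale b v"
  and tscale_tscale [simp]: "tscale a (tscale b v) = tscale (a * b) v"
  and tscale_one [simp]: "tscale 1 v = v"
  and tscale_zero_left [simp]: "tscale 0 v = 0"
  and tscale_zero_right [simp]: "tscale c 0 = 0"
  and tscale_diff_right: "tscale c (u - v) = tscale c u - tscale c v"
  by (rule poly_mapping_eqI; simp add: lookup_add lookup_minus algebra_simps)+

lemma tscale_sum: "tscale c (\<Sum>i\<in>A. f i) = (\<Sum>i\<in>A. tscale c (f i))"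
  by (induction A rule: infinite_finite_induct) (simp_all add: tscale_add_right)

text \<open>Linearity is asked on all formal combinations, across word lengths: the operators here
  are built from \<open>lin_ext\<close>, which is linear without restriction to one tensor
  power.\<close>

definition tlinear :: "(tens \<Rightarrow> tens) \<Rightarrow> bool" where
  "tlinear f \<longleftrightarrow>
     (\<forall>u v. f (u + v) = f u + f v) \<and> (\<forall>c v. f (tscale c v) = tscale c (f v))"

lemma tlinear_add: "tlinear f \<Longrightarrow> f (u + v) = f u + f v"
  and tlinear_tscale: "tlinear f \<Longrightarrow> f (tscale c v) = tscale c (f v)"
  by (auto simp: tlinear_def)

lemma tlinear_zero: "tlinear f \<Longrightarrow> f 0 = 0"
  by (metis tlinear_tscale tscale_zero_left)

lemma tlinear_id: "tlinear id"
  by (simp add: tlinear_def)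

lemma tlinear_comp: "tlinear f \<Longrightarrow> tlinear g \<Longrightarrow> tlinear (f \<circ> g)"
  by (simp add: tlinear_def)

lemma tlinear_foldr:
  "(\<And>f. f \<in> set fs \<Longrightarrow> tlinear f) \<Longrightarrow> tlinear (foldr (\<circ>) fs id)"
  by (induction fs) (auto simp: tlinear_id intro!: tlinear_comp)

text \<open>Words outside the support contribute zero. A common index set makes the sums for u, v
  and u + v comparable, as cancellation may shrink the support of u + v.\<close>

lemma lin_ext_mono:
  assumes "finite A" "Poly_Mapping.keys v \<subseteq> A"
  shows "lin_ext \<phi> v = (\<Sum>w\<in>A. tscale (lk v w) (\<phi> w))"
  unfolding lin_ext_def using assms
  by (intro sum.mono_neutral_left) (auto simp: in_keys_iff)

lemma tlinear_lin_ext: "tlinear (lin_ext \<phi>)"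
  unfolding tlinear_def
proof (intro conjI allI)
  fix u v :: tens
  let ?A = "Poly_Mapping.keys u \<union> Poly_Mapping.keys v"
  have "finite ?A" by simp
  then show "lin_ext \<phi> (u + v) = lin_ext \<phi> u + lin_ext \<phi> v"
    using Poly_Mapping.keys_add[of u v]
    by (simp add: lin_ext_mono[of ?A] lookup_add tscale_add_left sum.distrib)
next
  fix c and v :: tens
  have "Poly_Mapping.keys (tscale c v) \<subseteq> Poly_Mapping.keys v"
    by (auto simp: in_keys_iff)
  then show "lin_ext \<phi> (tscale c v) = tscale c (lin_ext \<phi> v)"
    by (simp add: lin_ext_mono[of "Poly_Mapping.keys v"] tscale_sum)
qed

lemma lin_ext_word [simp]: "lin_ext \<phi> (word w) = \<phi> w"
  by (simp add: lin_ext_def word_def)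

lemma lin_ext_word_self: "lin_ext word v = v"
  by (rule poly_mapping_eqI)
    (simp add: lin_ext_def lookup_sum lookup_word if_distrib [where f = "(*) _"] in_keys_iff
      cong: if_cong)

lemma tensor_eq_lin_ext: "tensor u v = lin_ext (\<lambda>w. lin_ext (\<lambda>w'. word (w @ w')) v) u"
  by (simp add: tensor_def lin_ext_def tscale_sum)

lemma tensor_word [simp]: "tensor (word w) (word w') = word (w @ w')"
  by (simp add: tensor_eq_lin_ext)

lemma tensor_add_left: "tensor (u + u') v = tensor u v + tensor u' v"
  and tensor_tscale_left: "tensor (tscale c u) v = tscale c (tensor u v)"
  by (simp_all add: tensor_eq_lin_ext tlinear_add tlinear_tscale tlinear_lin_ext)

lemma tensor_word_left: "tensor (word w) = lin_ext (\<lambda>w'. word (w @ w'))"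
  by (simp add: tensor_eq_lin_ext fun_eq_iff)

text \<open>A word on the left is the shape that \<open>R_at_word\<close> produces; there, linearity
  in the right factor is that of a single \<open>lin_ext\<close>.\<close>

lemma tensor_word_add: "tensor (word w) (u + v) = tensor (word w) u + tensor (word w) v"
  and tensor_word_tscale: "tensor (word w) (tscale c v) = tscale c (tensor (word w) v)"
  by (simp_all add: tensor_word_left tlinear_add tlinear_tscale tlinear_lin_ext)

lemma tlinear_map_tensor: "tlinear (map_tensor a f g)"
  by (simp add: map_tensor_def tlinear_lin_ext)

lemma map_tensor_word:
  "map_tensor a f g (word w) = tensor (f (word (take a w))) (g (word (drop a w)))"
  by (simp add: map_tensor_def)

lemma tlinear_R_at: "tlinear (R_at a)"
  by (simp add: R_at_def tlinear_map_tensor)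

lemma R_at_word:
  "R_at a (word w) = tensor (word (take a w))
     (tensor (R_map (word (take 2 (drop a w)))) (word (drop 2 (drop a w))))"
  by (simp add: R_at_def map_tensor_word)

lemma tlinear_d_left: "tlinear (d_left n i)"
  unfolding d_left_def
  by (intro tlinear_comp tlinear_map_tensor tlinear_foldr) (auto simp: tlinear_R_at)

lemma tlinear_d_right: "tlinear (d_right n i)"
  unfolding d_right_def
  by (intro tlinear_comp tlinear_map_tensor tlinear_foldr) (auto simp: tlinear_R_at)

lemma tlinear_YB_boundary: "tlinear (YB_boundary n)"
  unfolding tlinear_def YB_boundary_def
  by (simp add: tlinear_d_left tlinear_d_right tlinear_add tlinear_tscale tscale_sum
      tscale_add_right tscale_diff_right mult.commute flip: sum.distrib)
    (simp add: algebra_simps)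

text \<open>These rules push the operators through sums and scalars down to single words, where they
  are evaluated; the numerals become successors so that \<open>take\<close> and \<open>drop\<close>
  compute.\<close>

lemmas R_at_simps = R_at_word R_map_def mu_map_def map_tensor_word
  tlinear_add[OF tlinear_R_at] tlinear_tscale[OF tlinear_R_at]
  tlinear_add[OF tlinear_map_tensor] tlinear_tscale[OF tlinear_map_tensor]
  tensor_add_left tensor_tscale_left tensor_word_add tensor_word_tscale
  numeral_2_eq_2 numeral_3_eq_3

section \<open>The boundary maps on basis words\<close>

lemma sum_1_3: "(\<Sum>i=1..3. f (i::nat)) = f 1 + f 2 + (f 3 :: 'a :: comm_monoid_add)"
  and sum_1_4: "(\<Sum>i=1..4. f (i::nat)) = f 1 + f 2 + f 3 + (f 4 :: 'a :: comm_monoid_add)"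
  by (simp_all add: eval_nat_numeral ac_simps)

text \<open>Each composite of operators \<open>R_at\<close> is evaluated letter by letter; whatever
  remains is an identity between coefficients in k.\<close>

lemma YB_boundary_3_word:
  "YB_boundary 3 (word [E1,E1,E1]) = 0"
  "YB_boundary 3 (word [E1,E1,E2]) =
      tscale (1 - yvar^2) (tscale (1 + yvar^2) (word [E1,E1]) - word [E1,E2] -
        tscale (yvar^2) (word [E2,E1]))"
  "YB_boundary 3 (word [E1,E2,E1]) = 0"
  "YB_boundary 3 (word [E1,E2,E2]) =
      tscale (1 - yvar^2) (word [E1,E2] + tscale (yvar^2) (word [E2,E1]) -
        tscale (1 + yvar^2) (word [E2,E2]))"
  "YB_boundary 3 (word [E2,E1,E1]) = 0"
  "YB_boundary 3 (word [E2,E1,E2]) = 0"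
  "YB_boundary 3 (word [E2,E2,E1]) = 0"
  "YB_boundary 3 (word [E2,E2,E2]) = 0"
  unfolding YB_boundary_def sum_1_3
  by (simp add: d_left_def d_right_def upt_rec R_at_simps tscale_add_right,
      (rule poly_mapping_eqI, simp add: lookup_add lookup_minus algebra_simps power2_eq_square)?)+

text \<open>Write d for the boundary. The values satisfy d(1112) = -t d(1121), d(1222) = -t d(2122)
  and d(1212) = -t (d(1221) + d(2112)), so the boundaries of 1121, 1221, 2112 and 2122 generate all
  of them. Moreover d(1221) = (1 - t) A, d(2112) = (1 - t) A', d(1121) + d(1221) = (1 - t^2) (111 -
  221) and d(2112) + d(2122) = (1 - t^2) (222 - 211).\<close>

lemma YB_boundary_4_word:
  "YB_boundary 4 (word [E1,E1,E1,E1]) = 0"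
  "YB_boundary 4 (word [E1,E1,E1,E2]) =
      tscale (yvar^2 * (1 - yvar^2)) (word [E1,E2,E1] + tscale (yvar^2) (word [E2,E1,E1]) -
        tscale (1 + yvar^2) (word [E1,E1,E1]))"
  "YB_boundary 4 (word [E1,E1,E2,E1]) =
      tscale (yvar^2 - 1) (word [E1,E2,E1] + tscale (yvar^2) (word [E2,E1,E1]) -
        tscale (1 + yvar^2) (word [E1,E1,E1]))"
  "YB_boundary 4 (word [E1,E1,E2,E2]) = 0"
  "YB_boundary 4 (word [E1,E2,E1,E1]) = 0"
  "YB_boundary 4 (word [E1,E2,E1,E2]) =
      tscale (yvar^2 * (1 - yvar^2)) (word [E2,E1,E1] - word [E1,E2,E1] + word [E2,E2,E1] -
        word [E2,E1,E2])"
  "YB_boundary 4 (word [E1,E2,E2,E1]) =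
      tscale (1 - yvar^2) (word [E1,E2,E1] + tscale (yvar^2) (word [E2,E1,E1]) -
        tscale (1 + yvar^2) (word [E2,E2,E1]))"
  "YB_boundary 4 (word [E1,E2,E2,E2]) =
      tscale (yvar^2 * (1 - yvar^2)) (word [E2,E1,E2] + tscale (yvar^2) (word [E2,E2,E1]) -
        tscale (1 + yvar^2) (word [E2,E2,E2]))"
  "YB_boundary 4 (word [E2,E1,E1,E1]) = 0"
  "YB_boundary 4 (word [E2,E1,E1,E2]) =
      tscale (1 - yvar^2) (word [E2,E1,E2] + tscale (yvar^2) (word [E2,E2,E1]) -
        tscale (1 + yvar^2) (word [E2,E1,E1]))"
  "YB_boundary 4 (word [E2,E1,E2,E1]) = 0"
  "YB_boundary 4 (word [E2,E1,E2,E2]) =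
      tscale (yvar^2 - 1) (word [E2,E1,E2] + tscale (yvar^2) (word [E2,E2,E1]) -
        tscale (1 + yvar^2) (word [E2,E2,E2]))"
  "YB_boundary 4 (word [E2,E2,E1,E1]) = 0"
  "YB_boundary 4 (word [E2,E2,E1,E2]) = 0"
  "YB_boundary 4 (word [E2,E2,E2,E1]) = 0"
  "YB_boundary 4 (word [E2,E2,E2,E2]) = 0"
  unfolding YB_boundary_def sum_1_4
  by (simp add: d_left_def d_right_def upt_rec R_at_simps tscale_add_right,
      (rule poly_mapping_eqI, simp add: lookup_add lookup_minus algebra_simps power2_eq_square)?)+

section \<open>Cycles and boundaries in degree three\<close>

lemma lookup_yvar_power: "Poly_Mapping.lookup (yvar ^ n) k = (if k = int n then 1 else 0)"
proof -
  have "yvar ^ n = Poly_Mapping.single (int n) 1"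
    by (induction n) (simp_all add: yvar_def mult_single)
  then show ?thesis
    by (simp add: lookup_single when_def)
qed

text \<open>The coefficients at \<open>y^2\<close> of the first two elements are -1 and 1. The third
  inequality restates the second, for the factor \<open>- (1 + yvar^2)\<close> that appears at the
  word 22 in degree-three boundaries.\<close>

lemma yvar_neq: "1 - yvar^2 \<noteq> 0" "1 + yvar^2 \<noteq> 0" "- 1 \<noteq> yvar^2"
proof -
  have "Poly_Mapping.lookup (1 - yvar^2) 2 \<noteq> 0" "Poly_Mapping.lookup (1 + yvar^2) 2 \<noteq> 0"
    by (simp_all add: lookup_minus lookup_add lookup_yvar_power lookup_one when_def)
  then show "1 - yvar^2 \<noteq> 0" "1 + yvar^2 \<noteq> 0"
    by force+
  then show "- 1 \<noteq> yvar^2"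
    by (metis add.right_inverse)
qed

section \<open>Tensor powers as modules with a finite basis of words\<close>

lemma tensor_power_simps [simp]:
  "v \<in> carrier (tensor_power n) \<longleftrightarrow> (\<forall>w\<in>Poly_Mapping.keys v. length w = n)"
  "u \<oplus>\<^bsub>tensor_power n\<^esub> v = u + v"
  "\<zero>\<^bsub>tensor_power n\<^esub> = 0"
  "c \<odot>\<^bsub>tensor_power n\<^esub> v = tscale c v"
  by (simp_all add: tensor_power_def)

text \<open>Phrased by vanishing coefficients, closure under sums and multiples becomes a pointwise
  check.\<close>

lemma mem_tensor_power_iff:
  "v \<in> carrier (tensor_power n) \<longleftrightarrow> (\<forall>w. length w \<noteq> n \<longrightarrow> lk v w = 0)"
  by (auto simp: in_keys_iff)

lemma module_tensor_power: "module laurent_ring (tensor_power n)"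
proof (intro moduleI abelian_groupI)
  fix v assume "v \<in> carrier (tensor_power n)"
  then show "\<exists>u\<in>carrier (tensor_power n). u \<oplus>\<^bsub>tensor_power n\<^esub> v = \<zero>\<^bsub>tensor_power n\<^esub>"
    by (intro bexI[of _ "- v"]) (simp_all add: in_keys_iff)
qed (auto simp: cring_from_type_algebra mem_tensor_power_iff lookup_add tscale_add_left
    tscale_add_right ac_simps simp del: tensor_power_simps(1))

text \<open>Apply f to the expansion of v in words. Allowing any finite set that contains the
  support lets one sum over all words of a fixed length.\<close>

lemma tlinear_expand:
  assumes "tlinear f" "finite A" "Poly_Mapping.keys v \<subseteq> A"
  shows "f v = (\<Sum>w\<in>A. tscale (lk v w) (f (word w)))"
proof -
  have sum: "f (\<Sum>w\<in>A. g w) = (\<Sum>w\<in>A. f (g w))" for g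
    by (induction A rule: infinite_finite_induct)
      (simp_all add: tlinear_zero[OF assms(1)] tlinear_add[OF assms(1)])
  have "f v = f (lin_ext word v)"
    by (simp add: lin_ext_word_self)
  also have "\<dots> = (\<Sum>w\<in>A. tscale (lk v w) (f (word w)))"
    by (simp add: lin_ext_mono[OF assms(2,3)] sum tlinear_tscale[OF assms(1)])
  finally show ?thesis .
qed

text \<open>Splitting off the first letter gives a recursion that unrolls to the explicit lists of
  words of length 3 and 4.\<close>

lemma words_Suc: "{w. length w = Suc n} = (#) E1 ` {w. length w = n} \<union> (#) E2 ` {w. length w = n}"
proof (intro Set.set_eqI iffI)
  fix w :: "basis list" assume "w \<in> {w. length w = Suc n}"
  then obtain b u where "w = b # u" "length u = n"
    by (auto simp: length_Suc_conv)
  then show "w \<in> (#) E1 ` {w. length w = n} \<union> (#) E2 ` {w. length w = n}"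
    by (cases b) auto
qed auto

lemma words_0: "{w :: basis list. length w = 0} = {[]}"
  by auto

lemma finite_words: "finite {w :: basis list. length w = n}"
  by (induction n) (simp_all add: words_Suc words_0 del: length_0_conv)

lemma words_3: "{w. length w = 3} = {[E1,E1,E1], [E1,E1,E2], [E1,E2,E1], [E1,E2,E2], [E2,E1,E1],
    [E2,E1,E2], [E2,E2,E1], [E2,E2,E2]}"
  by (simp only: eval_nat_numeral BitM.simps One_nat_def words_Suc words_0 image_insert image_empty
      Un_insert_left Un_empty_left)

lemma words_4: "{w. length w = 4} = {[E1,E1,E1,E1], [E1,E1,E1,E2], [E1,E1,E2,E1], [E1,E1,E2,E2],
    [E1,E2,E1,E1], [E1,E2,E1,E2], [E1,E2,E2,E1], [E1,E2,E2,E2], [E2,E1,E1,E1], [E2,E1,E1,E2],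
    [E2,E1,E2,E1], [E2,E1,E2,E2], [E2,E2,E1,E1], [E2,E2,E1,E2], [E2,E2,E2,E1], [E2,E2,E2,E2]}"
  by (simp only: eval_nat_numeral BitM.simps One_nat_def words_Suc words_0 image_insert image_empty
      Un_insert_left Un_empty_left)

lemma YB_boundary_3:
  assumes "v \<in> carrier (tensor_power 3)"
  shows "YB_boundary 3 v =
    tscale (lk v [E1,E1,E2]) (YB_boundary 3 (word [E1,E1,E2]))
    + tscale (lk v [E1,E2,E2]) (YB_boundary 3 (word [E1,E2,E2]))"
proof -
  have "YB_boundary 3 v =
      (\<Sum>w\<in>{w. length w = 3}. tscale (lk v w) (YB_boundary 3 (word w)))"
    using assms by (intro tlinear_expand tlinear_YB_boundary finite_words) auto
  then show ?thesis
    unfolding words_3 by (simp add: YB_boundary_3_word ac_simps)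
qed

text \<open>The boundary of v has coefficient 1 - t^2 times that of v at 112 in the word 11, and -(1
  - t^2) times that of v at 122 in the word 22. As k is a domain, both must vanish in a
  cycle.\<close>

lemma YB_cycles_3:
  "v \<in> YB_cycles 3 \<longleftrightarrow>
     v \<in> carrier (tensor_power 3) \<and> lk v [E1,E1,E2] = 0 \<and> lk v [E1,E2,E2] = 0"
proof -
  have "lk v [E1,E1,E2] = 0 \<and> lk v [E1,E2,E2] = 0"
    if v: "v \<in> carrier (tensor_power 3)" and d: "YB_boundary 3 v = 0"
  proof -
    have "lk (YB_boundary 3 v) [E1,E1] = 0" "lk (YB_boundary 3 v) [E2,E2] = 0"
      by (simp_all add: d)
    then show ?thesis
      using yvar_neq by (simp add: YB_boundary_3[OF v] YB_boundary_3_word lookup_add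
        lookup_minus lookup_word)
  qed
  then show ?thesis
    by (auto simp: YB_cycles_def YB_boundary_3 simp del: tensor_power_simps(1))
qed

lemma YB_boundary_4:
  assumes "v \<in> carrier (tensor_power 4)"
  shows "YB_boundary 4 v =
    tscale (lk v [E1,E1,E1,E2]) (YB_boundary 4 (word [E1,E1,E1,E2]))
    + tscale (lk v [E1,E1,E2,E1]) (YB_boundary 4 (word [E1,E1,E2,E1]))
    + tscale (lk v [E1,E2,E1,E2]) (YB_boundary 4 (word [E1,E2,E1,E2]))
    + tscale (lk v [E1,E2,E2,E1]) (YB_boundary 4 (word [E1,E2,E2,E1]))
    + tscale (lk v [E1,E2,E2,E2]) (YB_boundary 4 (word [E1,E2,E2,E2]))
    + tscale (lk v [E2,E1,E1,E2]) (YB_boundary 4 (word [E2,E1,E1,E2]))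
    + tscale (lk v [E2,E1,E2,E2]) (YB_boundary 4 (word [E2,E1,E2,E2]))"
proof -
  have "YB_boundary 4 v =
      (\<Sum>w\<in>{w. length w = 4}. tscale (lk v w) (YB_boundary 4 (word w)))"
    using assms by (intro tlinear_expand tlinear_YB_boundary finite_words) auto
  then show ?thesis
    unfolding words_4 by (simp add: YB_boundary_4_word ac_simps)
qed

text \<open>
  The coordinates at \<open>A\<close>, \<open>A'\<close>, \<open>221 - 111\<close> and \<open>222 - 211\<close> are, up to sign, the coefficients at
  the words \<open>121\<close>, \<open>212\<close>, \<open>111\<close> and \<open>222\<close>. The functionals below give those at \<open>221\<close> and \<open>211\<close>.
\<close>

definition free_part1 :: "tens \<Rightarrow> laurent" where
  "free_part1 v = lk v [E2,E2,E1] + (1 + yvar^2) * lk v [E1,E2,E1] - yvar^2 * lk v [E2,E1,E2] +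
    lk v [E1,E1,E1]"

definition free_part2 :: "tens \<Rightarrow> laurent" where
  "free_part2 v = lk v [E2,E1,E1] + (1 + yvar^2) * lk v [E2,E1,E2] - yvar^2 * lk v [E1,E2,E1] +
    lk v [E2,E2,E2]"

lemma one_minus_yvar_4: "1 - yvar^4 = (1 - yvar^2) * (1 + yvar^2)"
  by (simp add: algebra_simps flip: power_add)

text \<open>This is the diagonal form of the boundary map, read off in coordinates. One direction
  expands an arbitrary preimage in words, the other constructs a preimage.\<close>

lemma YB_boundaries_3:
  "v \<in> YB_boundaries 3 \<longleftrightarrow> v \<in> YB_cycles 3 \<and> free_part1 v = 0 \<and> free_part2 v = 0
     \<and> 1 - yvar^2 dvd lk v [E1,E2,E1] \<and> 1 - yvar^2 dvd lk v [E2,E1,E2]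
     \<and> 1 - yvar^4 dvd lk v [E1,E1,E1] \<and> 1 - yvar^4 dvd lk v [E2,E2,E2]"
  (is "_ \<longleftrightarrow> ?R")
proof
  assume "v \<in> YB_boundaries 3"
  then obtain u where u: "u \<in> carrier (tensor_power 4)" and v: "v = YB_boundary 4 u"
    by (auto simp: YB_boundaries_def)
  \<comment> \<open>These are the coefficients of u at the seven words with nonzero
    boundary.\<close>
  define c0 where "c0 = lk u [E1,E1,E1,E2]"
  define c1 where "c1 = lk u [E1,E1,E2,E1]"
  define c2 where "c2 = lk u [E1,E2,E1,E2]"
  define c3 where "c3 = lk u [E1,E2,E2,E1]"
  define c4 where "c4 = lk u [E1,E2,E2,E2]"
  define c5 where "c5 = lk u [E2,E1,E1,E2]"
  define c6 where "c6 = lk u [E2,E1,E2,E2]"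
  have "lk v z = c0 * lk (YB_boundary 4 (word [E1,E1,E1,E2])) z + c1 * lk (YB_boundary 4 (word
    [E1,E1,E2,E1])) z + c2 * lk (YB_boundary 4 (word [E1,E2,E1,E2])) z + c3 * lk (YB_boundary 4
    (word [E1,E2,E2,E1])) z + c4 * lk (YB_boundary 4 (word [E1,E2,E2,E2])) z + c5 * lk
    (YB_boundary 4 (word [E2,E1,E1,E2])) z + c6 * lk (YB_boundary 4 (word [E2,E1,E2,E2])) z" for
    z
    by (simp add: v YB_boundary_4[OF u] lookup_add c0_def c1_def c2_def c3_def c4_def c5_def c6_def)
  note lk_v = this[unfolded YB_boundary_4_word]
  \<comment> \<open>Every boundary carries the factor \<open>1 - yvar^2\<close>. The words 111 and
    222 occur in boundaries only with the further factor \<open>1 + yvar^2\<close>, whence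
    \<open>1 - yvar^4\<close>.\<close>
  have coords:
    "lk v [E1,E1,E1] = (1 - yvar^4) * (c1 - yvar^2 * c0)"
    "lk v [E2,E2,E2] = (1 - yvar^4) * (c6 - yvar^2 * c4)"
    "lk v [E1,E2,E1] = (1 - yvar^2) * (yvar^2 * c0 - c1 - yvar^2 * c2 + c3)"
    "lk v [E2,E1,E2] = (1 - yvar^2) * (yvar^2 * c4 - yvar^2 * c2 + c5 - c6)"
    "lk v [E1,E1,E2] = 0" "lk v [E1,E2,E2] = 0"
    by (simp_all add: lk_v lookup_add lookup_minus lookup_word one_minus_yvar_4) (simp_all add:
      algebra_simps)
  have "free_part1 v = 0" "free_part2 v = 0"
    by (simp_all add: free_part1_def free_part2_def lk_v lookup_add lookup_minus lookup_word)
      (simp_all add: algebra_simps)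
  moreover have "lk v w = 0" if "length w \<noteq> 3" for w
    using that by (auto simp: lk_v lookup_add lookup_minus lookup_word)
  then have "v \<in> YB_cycles 3"
    by (auto simp: YB_cycles_3 coords mem_tensor_power_iff simp del: tensor_power_simps(1))
  ultimately show ?R
    by (simp add: coords)
next
  assume R: ?R
  then obtain p q r s where pqrs:
    "lk v [E1,E2,E1] = (1 - yvar^2) * p" "lk v [E2,E1,E2] = (1 - yvar^2) * q"
    "lk v [E1,E1,E1] = (1 - yvar^4) * r" "lk v [E2,E2,E2] = (1 - yvar^4) * s"
    by (elim conjE dvdE)
  have "v \<in> carrier (tensor_power 3)" and zeros: "lk v [E1,E1,E2] = 0" "lk v [E1,E2,E2] = 0"
    using R by (simp_all only: YB_cycles_3)
  then have zero: "lk v w = 0" if "length w \<noteq> 3" for w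
    using that by (auto simp: mem_tensor_power_iff simp del: tensor_power_simps(1))
  \<comment> \<open>The definitions of the free parts are solved for the coefficients at 221 and
    211; once the free parts vanish, the other four coefficients determine these two.\<close>
  have "lk v [E2,E2,E1] = free_part1 v
      + (yvar^2 * lk v [E2,E1,E2] - (1 + yvar^2) * lk v [E1,E2,E1] - lk v [E1,E1,E1])"
    and "lk v [E2,E1,E1] = free_part2 v
      + (yvar^2 * lk v [E1,E2,E1] - (1 + yvar^2) * lk v [E2,E1,E2] - lk v [E2,E2,E2])"
    by (simp_all add: free_part1_def free_part2_def)
  then have relations:
    "lk v [E2,E2,E1] = yvar^2 * lk v [E2,E1,E2] - (1 + yvar^2) * lk v [E1,E2,E1] - lk v [E1,E1,E1]"
    "lk v [E2,E1,E1] = yvar^2 * lk v [E1,E2,E1] - (1 + yvar^2) * lk v [E2,E1,E2] - lk v [E2,E2,E2]"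
    using R by (simp_all only: add_0)
  \<comment> \<open>The preimage is p 1221 + q 2112 + r (1221 + 1121) + s (2112 + 2122). Its
    boundary is p (1 - t) A + q (1 - t) A' + r (1 - t^2) (111 - 221) + s (1 - t^2) (222 - 211), with
    the right coefficients at 121, 212, 111 and 222; \<open>relations\<close> settles 221 and
    211.\<close>
  define u where "u = tscale (p + r) (word [E1,E2,E2,E1]) + tscale r (word [E1,E1,E2,E1])
    + tscale (q + s) (word [E2,E1,E1,E2]) + tscale s (word [E2,E1,E2,E2])"
  have "v = YB_boundary 4 u"
  proof (rule poly_mapping_eqI)
    fix w
    show "lk v w = lk (YB_boundary 4 u) w"
    proof (cases "length w = 3")
      case True
      then have "w \<in> {w. length w = 3}" by simp
      then show ?thesis
        unfolding words_3
        by (elim insertE emptyE)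
          (simp_all add: u_def tlinear_add[OF tlinear_YB_boundary] tlinear_tscale[OF
            tlinear_YB_boundary]
            YB_boundary_4_word lookup_add lookup_minus lookup_word zeros relations pqrs
              one_minus_yvar_4,
           (simp_all add: algebra_simps)?)
    next
      case False
      then show ?thesis
        by (auto simp: u_def tlinear_add[OF tlinear_YB_boundary] tlinear_tscale[OF
          tlinear_YB_boundary]
            YB_boundary_4_word lookup_add lookup_minus lookup_word zero)
    qed
  qed
  moreover have "u \<in> carrier (tensor_power 4)"
    by (auto simp: u_def mem_tensor_power_iff lookup_add lookup_word simp del:
      tensor_power_simps(1))
  ultimately show "v \<in> YB_boundaries 3"
    by (auto simp: YB_boundaries_def simp del: tensor_power_simps(1))
qed

section \<open>Cycles and boundaries as submodules\<close>

lemma submodule_tensorI: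
  assumes "H \<subseteq> carrier (tensor_power n)" "0 \<in> H"
    and "\<And>u v. u \<in> H \<Longrightarrow> v \<in> H \<Longrightarrow> u + v \<in> H"
    and "\<And>c v. v \<in> H \<Longrightarrow> tscale c v \<in> H"
  shows "submodule H laurent_ring (tensor_power n)"
proof -
  interpret module laurent_ring "tensor_power n" by (rule module_tensor_power)
  show ?thesis
  proof (rule submoduleI)
    fix v assume v: "v \<in> H"
    \<comment> \<open>Closure under negatives follows from closure under the scalar -1.\<close>
    have neg: "tscale (-1) v = - v"
      by (rule poly_mapping_eqI) simp
    have "\<ominus>\<^bsub>tensor_power n\<^esub> v = tscale (-1) v"
      using assms(1) assms(4)[OF v, of "-1"] v by (intro M.minus_equality) (auto simp: neg)
    then show "\<ominus>\<^bsub>tensor_power n\<^esub> v \<in> H"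
      using v by (simp add: assms(4))
  qed (use assms in auto)
qed

lemma submodule_YB_cycles: "submodule (YB_cycles n) laurent_ring (tensor_power n)"
  by (rule submodule_tensorI)
    (auto simp: YB_cycles_def mem_tensor_power_iff lookup_add tlinear_zero[OF tlinear_YB_boundary]
      tlinear_add[OF tlinear_YB_boundary] tlinear_tscale[OF tlinear_YB_boundary]
      simp del: tensor_power_simps(1))

definition cycle_module :: "(laurent, tens) module" where
  "cycle_module = (tensor_power 3)\<lparr>carrier := YB_cycles 3\<rparr>"

lemma cycle_module_simps [simp]:
  "carrier cycle_module = YB_cycles 3"
  "u \<oplus>\<^bsub>cycle_module\<^esub> v = u + v"
  "c \<odot>\<^bsub>cycle_module\<^esub> v = tscale c v"
  by (simp_all add: cycle_module_def tensor_power_def)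

lemma module_cycle_module: "module laurent_ring cycle_module"
  unfolding cycle_module_def
  by (rule submodule.submodule_is_module[OF submodule_YB_cycles module_tensor_power])

text \<open>Boundaries form the image of a linear map, hence a submodule of the tensor power. That
  they are cycles is part of \<open>YB_boundaries_3\<close>, which rests on explicit values instead
  of a general proof that the boundary squares to zero.\<close>

lemma submodule_YB_boundaries: "submodule (YB_boundaries 3) laurent_ring cycle_module"
proof -
  interpret module laurent_ring cycle_module by (rule module_cycle_module)
  have "submodule (YB_boundaries 3) laurent_ring (tensor_power 3)"
  proof (rule submodule_tensorI)
    show "YB_boundaries 3 \<subseteq> carrier (tensor_power 3)"
      by (auto simp: YB_boundaries_3 YB_cycles_3 simp del: tensor_power_simps(1))
    have "0 \<in> carrier (tensor_power (Suc 3))"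
      by simp
    then have "YB_boundary (Suc 3) 0 \<in> YB_boundaries 3"
      unfolding YB_boundaries_def by (rule imageI)
    then show "0 \<in> YB_boundaries 3"
      by (simp add: tlinear_zero[OF tlinear_YB_boundary])
  next
    fix u v assume "u \<in> YB_boundaries 3" "v \<in> YB_boundaries 3"
    then obtain u' v' where "u' \<in> carrier (tensor_power 4)" "v' \<in> carrier (tensor_power 4)"
      "u = YB_boundary 4 u'" "v = YB_boundary 4 v'"
      by (auto simp: YB_boundaries_def)
    then show "u + v \<in> YB_boundaries 3"
      by (auto simp: YB_boundaries_def tlinear_add[OF tlinear_YB_boundary, symmetric]
          mem_tensor_power_iff lookup_add simp del: tensor_power_simps(1) intro!: imageI)
  next
    fix c v assume "v \<in> YB_boundaries 3"
    then obtain v' where "v' \<in> carrier (tensor_power 4)" "v = YB_boundary 4 v'"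
      by (auto simp: YB_boundaries_def)
    then show "tscale c v \<in> YB_boundaries 3"
      by (auto simp: YB_boundaries_def tlinear_tscale[OF tlinear_YB_boundary, symmetric]
          mem_tensor_power_iff simp del: tensor_power_simps(1) intro!: imageI)
  qed
  \<comment> \<open>The operations on the cycles are those of the tensor power, so the boundaries
    are a module under them too, and inclusion in the cycles makes them a submodule there.\<close>
  then have "module laurent_ring (cycle_module\<lparr>carrier := YB_boundaries 3\<rparr>)"
    using submodule.submodule_is_module[OF _ module_tensor_power]
    by (simp add: cycle_module_def)
  then show ?thesis
    by (intro module_incl_imp_submodule) (auto simp: YB_boundaries_3)
qed

section \<open>The isomorphism induced by the coordinate functions\<close>

theorem theorem5p7:
  shows "module_isomorphic laurent_ring (YB_homology 3)
    (direct_sum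
      (direct_sum (regular_module laurent_ring) (regular_module laurent_ring))
      (direct_sum
        (direct_sum (cyclic_module (1 - yvar^2)) (cyclic_module (1 - yvar^2)))
        (direct_sum (cyclic_module (1 - yvar^4)) (cyclic_module (1 - yvar^4)))))"
    (is "module_isomorphic _ _ ?N")
proof -
  \<comment> \<open>Torsion coordinates are reduced modulo their divisors. The coefficient at 111 is
    minus the coordinate at 221 - 111; this sign only changes h by an automorphism of that
    summand.\<close>
  define h where "h v =
    ((free_part1 v, free_part2 v),
     (residue (1 - yvar^2) (lk v [E1,E2,E1]), residue (1 - yvar^2) (lk v [E2,E1,E2])),
     (residue (1 - yvar^4) (lk v [E1,E1,E1]), residue (1 - yvar^4) (lk v [E2,E2,E2])))" for v
  have "module_isomorphic laurent_ring (quotient_module cycle_module (YB_boundaries 3)) ?N"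
  proof (rule first_isomorphism[OF module_cycle_module submodule_YB_boundaries, where h = h])
    show "h ` carrier cycle_module = carrier ?N"
    proof
      show "h ` carrier cycle_module \<subseteq> carrier ?N"
        by (auto simp: h_def regular_module_simps carrier_cyclic_module)
    next
      show "carrier ?N \<subseteq> h ` carrier cycle_module"
      proof
        fix n assume "n \<in> carrier ?N"
        then obtain p q a b c d where n: "n = ((p, q),
            (residue (1 - yvar^2) a, residue (1 - yvar^2) b),
            (residue (1 - yvar^4) c, residue (1 - yvar^4) d))"
          by (auto simp: carrier_cyclic_module)
        \<comment> \<open>The coefficients at 221 and 211 solve \<open>free_part1 v = p\<close> and
          \<open>free_part2 v = q\<close> once the other four are chosen as a, b, c, d.\<close>
        define v where "v = tscale a (word [E1,E2,E1]) + tscale b (word [E2,E1,E2])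
          + tscale c (word [E1,E1,E1]) + tscale d (word [E2,E2,E2])
          + tscale (p - (1 + yvar^2) * a + yvar^2 * b - c) (word [E2,E2,E1])
          + tscale (q - (1 + yvar^2) * b + yvar^2 * a - d) (word [E2,E1,E1])"
        have "v \<in> YB_cycles 3"
          by (auto simp: v_def YB_cycles_3 mem_tensor_power_iff lookup_add lookup_word
              simp del: tensor_power_simps(1))
        moreover have "h v = n"
          by (simp add: v_def h_def n free_part1_def free_part2_def lookup_add lookup_word)
        ultimately show "n \<in> h ` carrier cycle_module"
          by auto
      qed
    qed
  next
    fix u v assume "u \<in> carrier cycle_module" "v \<in> carrier cycle_module"
    show "h (u \<oplus>\<^bsub>cycle_module\<^esub> v) = h u \<oplus>\<^bsub>?N\<^esub> h v"
      by (simp add: h_def regular_module_simps add_cyclic_module lookup_add)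
        (simp add: free_part1_def free_part2_def lookup_add algebra_simps)
  next
    fix c v assume "v \<in> carrier cycle_module"
    show "h (c \<odot>\<^bsub>cycle_module\<^esub> v) = c \<odot>\<^bsub>?N\<^esub> h v"
      by (simp add: h_def regular_module_simps smult_cyclic_module)
        (simp add: free_part1_def free_part2_def algebra_simps)
  next
    fix u v assume uv: "u \<in> carrier cycle_module" "v \<in> carrier cycle_module"
    \<comment> \<open>By linearity equality of values is a condition on u - v, and it is the
      criterion of \<open>YB_boundaries_3\<close>; that u - v is a cycle is clear from u and
      v.\<close>
    have "h u = h v \<longleftrightarrow> free_part1 (u - v) = 0 \<and> free_part2 (u - v) = 0
        \<and> 1 - yvar^2 dvd lk (u - v) [E1,E2,E1] \<and> 1 - yvar^2 dvd lk (u - v) [E2,E1,E2]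
        \<and> 1 - yvar^4 dvd lk (u - v) [E1,E1,E1] \<and> 1 - yvar^4 dvd lk (u - v) [E2,E2,E2]"
    proof -
      have "free_part1 (u - v) = free_part1 u - free_part1 v"
        "free_part2 (u - v) = free_part2 u - free_part2 v"
        by (simp_all add: free_part1_def free_part2_def lookup_minus algebra_simps)
      then show ?thesis
        by (simp add: h_def residue_eq_iff lookup_minus)
    qed
    also have "\<dots> \<longleftrightarrow> u - v \<in> YB_boundaries 3"
      using uv by (auto simp: YB_boundaries_3 YB_cycles_3 mem_tensor_power_iff lookup_minus
          simp del: tensor_power_simps(1))
    also have "\<dots> \<longleftrightarrow> (\<exists>b\<in>YB_boundaries 3. u = b \<oplus>\<^bsub>cycle_module\<^esub> v)"
      by (auto intro!: bexI[of _ "u - v"])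
    also have "\<dots> \<longleftrightarrow> YB_boundaries 3 +>\<^bsub>cycle_module\<^esub> u = YB_boundaries 3 +>\<^bsub>cycle_module\<^esub> v"
      using module.coset_eq_iff[OF module_cycle_module submodule_YB_boundaries uv] by simp
    finally show "h u = h v \<longleftrightarrow>
        YB_boundaries 3 +>\<^bsub>cycle_module\<^esub> u = YB_boundaries 3 +>\<^bsub>cycle_module\<^esub> v" .
  qed
  then show ?thesis
    by (simp add: YB_homology_def cycle_module_def)
qed

end
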